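(* Let $G$ be a hereditarily just-infinite group, and let $\mathcal{H}$ be a non-trivial URS of $G$. Then for every $H\in\mathcal{H}$, $H$ is co-finitely dense in $G$ for the profinite topology, i.e. the closure of $H$ in the profinite topology on $G$ is a finite index subgroup of $G$.
   Context: A group $G$ is just-infinite if $G$ is infinite and $G/N$ is finite for every non-trivial normal subgroup $N$ of $G$; $G$ is hereditarily just-infinite if every finite index subgroup of $G$ is just-infinite. $\mathrm{Sub}(G)$ is the set of subgroups of $G$ with the topology induced from the product topology on $\{0,1\}^G$, on which $G$ acts by conjugation. A URS of $G$ is a non-empty closed $G$-invariant minimal subset of $\mathrm{Sub}(G)$ (minimal: every $G$-orbit in it is dense in it). The trivial URS is the singleton $\{\{1\}\}$. The profinite topology on $G$ is the group topology with basis the cosets $gN$, $g\in G$, $N$ a finite index normal subgroup of $G$; the profinite closure of a subgroup $H$ is $\bigcap_N HN$ over all finite index normal subgroups $N$ of $G$. *)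

theory Defs
  imports "HOL-Analysis.Analysis" "HOL-Algebra.Group_Action"
begin

text \<open>These two library notations clash with left cosets and with the topological closure.\<close>

no_notation subset_mset (infix \<open><#\<close> 50)
no_notation eq_closure_of (\<open>closure'_of\<index>\<close>)

definition finite_index_subgroup :: "'a set \<Rightarrow> ('a, 'b) monoid_scheme \<Rightarrow> bool"
  where "finite_index_subgroup H G \<longleftrightarrow> subgroup H G \<and> finite (rcosets\<^bsub>G\<^esub> H)"

definition just_infinite :: "('a, 'b) monoid_scheme \<Rightarrow> bool"
  where "just_infinite G \<longleftrightarrow>
    group G \<and> infinite (carrier G) \<and>
    (\<forall>N. N \<lhd> G \<longrightarrow> N \<noteq> {\<one>\<^bsub>G\<^esub>} \<longrightarrow> finite (carrier (G Mod N)))"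

definition hereditarily_just_infinite :: "('a, 'b) monoid_scheme \<Rightarrow> bool"
  where "hereditarily_just_infinite G \<longleftrightarrow>
    group G \<and> (\<forall>K. finite_index_subgroup K G \<longrightarrow> just_infinite (G\<lparr>carrier := K\<rparr>))"

text \<open>A subgroup is identified with its indicator function on the carrier, that is, with a point of
  the product of copies of the discrete two-point space \<^typ>\<open>bool\<close> indexed by the carrier.\<close>

definition Sub_topology :: "('a, 'b) monoid_scheme \<Rightarrow> 'a set topology"
  where "Sub_topology G =
    pullback_topology {H. subgroup H G} (\<lambda>H. \<lambda>g \<in> carrier G. g \<in> H)
      (product_topology (\<lambda>_. discrete_topology (UNIV :: bool set)) (carrier G))"

definition Sub_conj :: "('a, 'b) monoid_scheme \<Rightarrow> 'a \<Rightarrow> 'a set \<Rightarrow> 'a set"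
  where "Sub_conj G = (\<lambda>g. \<lambda>H \<in> {H. subgroup H G}. g <#\<^bsub>G\<^esub> H #>\<^bsub>G\<^esub> inv\<^bsub>G\<^esub> g)"

definition URS :: "('a, 'b) monoid_scheme \<Rightarrow> 'a set set \<Rightarrow> bool"
  where "URS G \<H> \<longleftrightarrow>
    \<H> \<noteq> {} \<and>
    closedin (Sub_topology G) \<H> \<and>
    (\<forall>g \<in> carrier G. \<forall>H \<in> \<H>. Sub_conj G g H \<in> \<H>) \<and>
    (\<forall>H \<in> \<H>. \<H> \<subseteq> Sub_topology G closure_of orbit G (Sub_conj G) H)"

definition profinite_topology :: "('a, 'b) monoid_scheme \<Rightarrow> 'a topology"
  where "profinite_topology G =
    topology_generated_by
      {g <#\<^bsub>G\<^esub> N | g N. g \<in> carrier G \<and> N \<lhd> G \<and> finite_index_subgroup N G}"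

lemma topspace_Sub_topology: "topspace (Sub_topology G) = {H. subgroup H G}"
  by (auto simp: Sub_topology_def topspace_pullback_topology)

lemma (in group) Sub_conj_action: "group_action G {H. subgroup H G} (Sub_conj G)"
  unfolding Sub_conj_def by (rule action_by_conjugation_on_subgroups_set)

lemma (in group) finite_index_carrier: "carrier G \<lhd> G" "finite_index_subgroup (carrier G) G"
proof -
  show "carrier G \<lhd> G"
    by (simp add: normal_inv_iff subgroup_self)
  have "rcosets (carrier G) \<subseteq> {carrier G}"
    by (auto simp: RCOSETS_def coset_join2 subgroup_self)
  then show "finite_index_subgroup (carrier G) G"
    by (auto simp: finite_index_subgroup_def subgroup_self intro: finite_subset)
qed

lemma (in group) finite_index_Int:
  assumes "finite_index_subgroup A G" "finite_index_subgroup B G"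
  shows "finite_index_subgroup (A \<inter> B) G"
proof -
  have A: "subgroup A G" "finite (rcosets A)" and B: "subgroup B G" "finite (rcosets B)"
    using assms by (auto simp: finite_index_subgroup_def)
  have inter: "(A \<inter> B) #> x = (A #> x) \<inter> (B #> x)" if "x \<in> carrier G" for x
  proof
    show "(A #> x) \<inter> (B #> x) \<subseteq> (A \<inter> B) #> x"
    proof
      fix y assume "y \<in> (A #> x) \<inter> (B #> x)"
      then obtain a b where ab: "a \<in> A" "b \<in> B" "y = a \<otimes> x" "y = b \<otimes> x"
        by (auto simp: r_coset_def)
      then have "a = b"
        using that A B by (metis right_cancel subgroup.mem_carrier)
      then show "y \<in> (A \<inter> B) #> x"
        using ab by (auto simp: r_coset_def)
    qed
  qed (auto simp: r_coset_def)
  have "rcosets (A \<inter> B) \<subseteq> (\<lambda>(X, Y). X \<inter> Y) ` ((rcosets A) \<times> (rcosets B))"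
    by (force simp: RCOSETS_def inter)
  then show ?thesis
    unfolding finite_index_subgroup_def
    using A B finite_subset subgroups_Inter_pair by blast
qed

lemma (in group) topspace_profinite_topology: "topspace (profinite_topology G) = carrier G"
proof -
  have "g <# N \<subseteq> carrier G" if "g \<in> carrier G" "N \<lhd> G" for g N
    using that by (simp add: l_coset_subset_G normal_imp_subgroup subgroup.subset)
  moreover have "g \<in> g <# carrier G" if "g \<in> carrier G" for g
    using that by (auto simp: l_coset_def intro!: bexI[of _ \<one>])
  ultimately show ?thesis
    unfolding profinite_topology_def topology_generated_by_topspace
    using finite_index_carrier by blast
qed

lemma (in group) openin_profinite_topology_iff:
  "openin (profinite_topology G) U \<longleftrightarrow>
    U \<subseteq> carrier G \<and> (\<forall>x \<in> U. \<exists>N. N \<lhd> G \<and> finite_index_subgroup N G \<and> x <# N \<subseteq> U)"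
  (is "_ \<longleftrightarrow> _ \<and> ?nhd U")
proof safe
  fix x assume "openin (profinite_topology G) U" "x \<in> U"
  then show "x \<in> carrier G"
    using openin_subset topspace_profinite_topology by blast
next
  fix x assume U: "openin (profinite_topology G) U" and x: "x \<in> U"
  have "generate_topology_on
      {g <# N | g N. g \<in> carrier G \<and> N \<lhd> G \<and> finite_index_subgroup N G} U"
    using U by (simp add: profinite_topology_def openin_topology_generated_by_iff)
  then have "?nhd U"
  proof induction
    case Empty
    show ?case by simp
  next
    case (Int a b)
    show ?case
    proof
      fix x assume "x \<in> a \<inter> b"
      then obtain M N where "M \<lhd> G" "finite_index_subgroup M G" "x <# M \<subseteq> a"
        and "N \<lhd> G" "finite_index_subgroup N G" "x <# N \<subseteq> b"
        using Int.IH by blast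
      then have "M \<inter> N \<lhd> G \<and> finite_index_subgroup (M \<inter> N) G \<and> x <# (M \<inter> N) \<subseteq> a \<inter> b"
        by (auto simp: l_coset_def normal_subgroup_intersect finite_index_Int)
      then show "\<exists>N. N \<lhd> G \<and> finite_index_subgroup N G \<and> x <# N \<subseteq> a \<inter> b" ..
    qed
  next
    case (UN K)
    then show ?case by (meson Union_iff Union_upper subset_trans)
  next
    case (Basis s)
    then obtain g N where s: "s = g <# N" "g \<in> carrier G" "N \<lhd> G" "finite_index_subgroup N G"
      by blast
    have "x <# N = s" if "x \<in> s" for x
      using s that l_repr_independence normal_imp_subgroup by blast
    then show ?case using s by blast
  qed
  then show "\<exists>N. N \<lhd> G \<and> finite_index_subgroup N G \<and> x <# N \<subseteq> U"
    using x by blast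
next
  assume U: "U \<subseteq> carrier G" and nhd: "?nhd U"
  show "openin (profinite_topology G) U"
  proof (subst openin_subopen, intro ballI)
    fix x assume x: "x \<in> U"
    then obtain N where N: "N \<lhd> G" "finite_index_subgroup N G" "x <# N \<subseteq> U"
      using nhd by blast
    have "\<one> \<in> N"
      using N(1) normal_imp_subgroup subgroup.one_closed by blast
    then have "x \<in> x <# N"
      using x U by (auto simp: l_coset_def intro!: bexI[of _ \<one>])
    moreover have "openin (profinite_topology G) (x <# N)"
      unfolding profinite_topology_def
      by (rule topology_generated_by_Basis) (use x U N in blast)
    ultimately show "\<exists>T. openin (profinite_topology G) T \<and> x \<in> T \<and> T \<subseteq> U"
      using N(3) by blast
  qed
qed

lemma (in group) profinite_closure_eq:
  assumes H: "subgroup H G"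
  shows "profinite_topology G closure_of H =
    (\<Inter>N \<in> {N. N \<lhd> G \<and> finite_index_subgroup N G}. H <#> N)"
proof -
  have meet: "(x <# N) \<inter> H \<noteq> {} \<longleftrightarrow> x \<in> H <#> N" if x: "x \<in> carrier G" and N: "N \<lhd> G" for x N
  proof -
    have sN: "subgroup N G" using N by (rule normal_imp_subgroup)
    have sub: "H \<subseteq> carrier G" "N \<subseteq> carrier G"
      using H sN by (auto dest: subgroup.subset)
    show ?thesis
    proof
      assume "(x <# N) \<inter> H \<noteq> {}"
      then obtain n where n: "n \<in> N" "x \<otimes> n \<in> H" by (auto simp: l_coset_def)
      then have "x = (x \<otimes> n) \<otimes> inv n" "inv n \<in> N"
        using x sub sN by (auto simp: m_assoc subgroup.m_inv_closed subset_iff)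
      then show "x \<in> H <#> N" using n unfolding set_mult_def by blast
    next
      assume "x \<in> H <#> N"
      then obtain h n where hn: "h \<in> H" "n \<in> N" "x = h \<otimes> n" by (auto simp: set_mult_def)
      then have "h = x \<otimes> inv n" "inv n \<in> N"
        using sub sN by (auto simp: m_assoc subgroup.m_inv_closed subset_iff)
      then show "(x <# N) \<inter> H \<noteq> {}" using hn unfolding l_coset_def by blast
    qed
  qed
  have opn: "openin (profinite_topology G) (x <# N)" and mem: "x \<in> x <# N"
    if "x \<in> carrier G" "N \<lhd> G" "finite_index_subgroup N G" for x N
  proof -
    show "openin (profinite_topology G) (x <# N)"
      unfolding profinite_topology_def
      by (rule topology_generated_by_Basis) (use that in blast)
    have "\<one> \<in> N"
      using that normal_imp_subgroup subgroup.one_closed by blast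
    then show "x \<in> x <# N"
      using that by (auto simp: l_coset_def intro!: bexI[of _ \<one>])
  qed
  have "x \<in> profinite_topology G closure_of H \<longleftrightarrow>
      x \<in> carrier G \<and> (\<forall>N. N \<lhd> G \<and> finite_index_subgroup N G \<longrightarrow> (x <# N) \<inter> H \<noteq> {})" for x
  proof -
    have "x \<in> profinite_topology G closure_of H \<longleftrightarrow>
        x \<in> carrier G \<and> (\<forall>T. x \<in> T \<and> openin (profinite_topology G) T \<longrightarrow> T \<inter> H \<noteq> {})"
      by (auto simp: in_closure_of topspace_profinite_topology)
    also have "\<dots> \<longleftrightarrow>
        x \<in> carrier G \<and> (\<forall>N. N \<lhd> G \<and> finite_index_subgroup N G \<longrightarrow> (x <# N) \<inter> H \<noteq> {})"
    proof safe
      fix N assume "x \<in> carrier G" "N \<lhd> G" "finite_index_subgroup N G" "(x <# N) \<inter> H = {}"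
        and "\<forall>T. x \<in> T \<and> openin (profinite_topology G) T \<longrightarrow> T \<inter> H \<noteq> {}"
      then show False using opn mem by blast
    next
      fix T
      assume *: "\<forall>N. N \<lhd> G \<and> finite_index_subgroup N G \<longrightarrow> (x <# N) \<inter> H \<noteq> {}"
        and T: "x \<in> T" "openin (profinite_topology G) T" "T \<inter> H = {}"
      obtain N where "N \<lhd> G" "finite_index_subgroup N G" "x <# N \<subseteq> T"
        using T openin_profinite_topology_iff by blast
      then show False using * T(3) by blast
    qed
    finally show ?thesis .
  qed
  then have "x \<in> profinite_topology G closure_of H \<longleftrightarrow>
      x \<in> carrier G \<and> (\<forall>N. N \<lhd> G \<and> finite_index_subgroup N G \<longrightarrow> x \<in> H <#> N)" for x
    using meet by blast
  moreover have "H <#> carrier G \<subseteq> carrier G"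
    using H by (simp add: set_mult_closed subgroup.subset)
  ultimately show ?thesis
    using finite_index_carrier by blast
qed

end

theory Submission
  imports Defs "HOL-Algebra.Zassenhaus"
begin

text \<open>
  Write \<open>K\<close> for the profinite closure of \<open>H\<close>. Since the URS is closed and does not contain the
  trivial subgroup, \<open>H\<close> is confined: some finite set \<open>P\<close> of non-trivial elements meets every
  conjugate of \<open>H\<close> (\<open>URS_meets_finite_set\<close>). Confinement says
  that \<open>G\<close> is the union over \<open>p \<in> P\<close> of the transporters
  \<open>X p = {g. g\<^sup>-\<^sup>1 p g \<in> K}\<close>. These are finitely many, and they are closed for the profinite
  topology (\<open>closedin_profinite_transporter\<close>), so one of them has non-empty interior
  (\<open>finite_closed_cover_of_open\<close>), that is, contains a coset \<open>g N\<close> of a normal subgroup \<open>N\<close> of finite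
  index. Then the non-trivial element \<open>q = g\<^sup>-\<^sup>1 p g\<close> has all its \<open>N\<close>-conjugates in \<open>K\<close>.

  This is where just-infiniteness of finite index subgroups enters
  (\<open>finite_index_if_contains_conjugates\<close>): the elements whose \<open>N\<close>-conjugates all lie in \<open>K\<close> form a
  subgroup \<open>M \<subseteq> K\<close>, non-trivial because of \<open>q\<close>, whose normalizer \<open>L\<close> contains \<open>N\<close> and so has finite
  index. As \<open>L\<close> is just-infinite, \<open>M\<close> has finite index in \<open>L\<close>, hence in \<open>G\<close>, and so does \<open>K\<close>.
\<close>

(* The notation for closure in a setoid clashes with that for topological closure. *)
no_notation eq_closure_of (\<open>closure'_of\<index>\<close>)

section \<open>Subgroups of finite index\<close>

lemma (in group) inv_cancel_assoc:
  assumes "x \<in> carrier G" "y \<in> carrier G"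
  shows "inv x \<otimes> (x \<otimes> y) = y" "x \<otimes> (inv x \<otimes> y) = y"
  using assms by (simp_all flip: m_assoc)

lemma (in group) conj_mult_inv:
  assumes "n \<in> carrier G" "x \<in> carrier G" "y \<in> carrier G"
  shows "inv n \<otimes> (x \<otimes> y) \<otimes> n = (inv n \<otimes> x \<otimes> n) \<otimes> (inv n \<otimes> y \<otimes> n)"
    "inv n \<otimes> inv x \<otimes> n = inv (inv n \<otimes> x \<otimes> n)"
  using assms by (simp_all add: m_assoc inv_mult_group inv_cancel_assoc)

text \<open>
  Multiplication by \<open>B\<close> on the left maps the cosets of \<open>A\<close> onto those of \<open>B\<close>.
\<close>

lemma (in group) finite_index_subgroup_mono:
  assumes A: "finite_index_subgroup A G" and B: "subgroup B G" and "A \<subseteq> B"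
  shows "finite_index_subgroup B G"
proof -
  have sA: "subgroup A G" and fin: "finite (rcosets A)"
    using A by (auto simp: finite_index_subgroup_def)
  have "rcosets B \<subseteq> (\<lambda>X. B <#> X) ` (rcosets A)"
  proof
    fix Y assume "Y \<in> rcosets B"
    then obtain x where x: "x \<in> carrier G" "Y = B #> x"
      by (auto simp: RCOSETS_def)
    have "B <#> A = B"
      by (rule set_mult_subgroup_idem) (use sA B \<open>A \<subseteq> B\<close> in \<open>auto intro: subgroup_incl\<close>)
    then have "B <#> (A #> x) = B #> x"
      using x sA B by (simp add: setmult_rcos_assoc subgroup.subset)
    then show "Y \<in> (\<lambda>X. B <#> X) ` (rcosets A)"
      using x by (auto simp: RCOSETS_def)
  qed
  then have "finite (rcosets B)"
    using fin by (rule finite_surj[rotated])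
  then show ?thesis
    using B by (simp add: finite_index_subgroup_def)
qed

text \<open>
  Choose representatives \<open>r X\<close> of the cosets \<open>X\<close> of \<open>L\<close>. An element of \<open>X\<close> is \<open>l \<otimes> r X\<close> with
  \<open>l \<in> L\<close>, so each coset of \<open>M\<close> is determined by a coset of \<open>M\<close> in \<open>L\<close> and a coset of \<open>L\<close>.
\<close>

lemma (in group) finite_index_subgroup_trans:
  assumes L: "finite_index_subgroup L G" and M: "subgroup M G"
    and fin: "finite (rcosets\<^bsub>G\<lparr>carrier := L\<rparr>\<^esub> M)"
  shows "finite_index_subgroup M G"
proof -
  have sL: "subgroup L G" and finL: "finite (rcosets L)"
    using L by (auto simp: finite_index_subgroup_def)
  have "\<exists>x. x \<in> carrier G \<and> X = L #> x" if "X \<in> rcosets L" for X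
    using that by (auto simp: RCOSETS_def)
  then obtain r where r: "\<And>X. X \<in> rcosets L \<Longrightarrow> r X \<in> carrier G \<and> X = L #> r X"
    by metis
  have "rcosets M \<subseteq>
      (\<lambda>(C, X). C #> r X) ` ((rcosets\<^bsub>G\<lparr>carrier := L\<rparr>\<^esub> M) \<times> (rcosets L))"
  proof
    fix Y assume "Y \<in> rcosets M"
    then obtain x where x: "x \<in> carrier G" "Y = M #> x"
      by (auto simp: RCOSETS_def)
    define X where "X = L #> x"
    have X: "X \<in> rcosets L" using x by (auto simp: RCOSETS_def X_def)
    have "x \<in> L #> r X"
      using r[OF X] x sL rcos_self by (metis X_def)
    then obtain l where l: "l \<in> L" "x = l \<otimes> r X" by (auto simp: r_coset_def)
    have "Y = (M #> l) #> r X"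
      using l x r[OF X] sL M by (simp add: coset_mult_assoc subgroup.subset subgroup.mem_carrier)
    moreover have "M #> l \<in> rcosets\<^bsub>G\<lparr>carrier := L\<rparr>\<^esub> M"
      using l by (auto simp: RCOSETS_def r_coset_def)
    ultimately show "Y \<in> (\<lambda>(C, X). C #> r X) `
        ((rcosets\<^bsub>G\<lparr>carrier := L\<rparr>\<^esub> M) \<times> (rcosets L))"
      using X by force
  qed
  then have "finite (rcosets M)"
    using fin finL by (meson finite_SigmaI finite_surj)
  then show ?thesis
    using M by (simp add: finite_index_subgroup_def)
qed

text \<open>
  The elements whose \<open>N\<close>-conjugates all lie in \<open>K\<close> form the intersection of the \<open>N\<close>-conjugates
  of \<open>K\<close>. It is a subgroup of \<open>K\<close> that \<open>N\<close> normalizes, hence a non-trivial normal subgroup of a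
  just-infinite group: its normalizer in \<open>G\<close>, which has finite index because it contains \<open>N\<close>.
\<close>

lemma (in group) finite_index_if_contains_conjugates:
  assumes hji: "hereditarily_just_infinite G"
    and K: "subgroup K G" and N: "finite_index_subgroup N G"
    and q: "q \<in> carrier G" "q \<noteq> \<one>"
    and conj: "\<And>n. n \<in> N \<Longrightarrow> inv n \<otimes> q \<otimes> n \<in> K"
  shows "finite_index_subgroup K G"
proof -
  have sN: "subgroup N G" using N by (simp add: finite_index_subgroup_def)
  note NG = subgroup.mem_carrier[OF sN] and KG = subgroup.mem_carrier[OF K]
  define M where "M = {x \<in> carrier G. \<forall>n \<in> N. inv n \<otimes> x \<otimes> n \<in> K}"
  have qM: "q \<in> M" using q conj by (auto simp: M_def)
  have MK: "M \<subseteq> K"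
    using subgroup.one_closed[OF sN] by (force simp: M_def)
  have sM: "subgroup M G"
  proof (rule subgroupI)
    fix a b assume ab: "a \<in> M" "b \<in> M"
    then show "a \<otimes> b \<in> M"
      using K NG by (auto simp: M_def conj_mult_inv subgroup.m_closed)
    show "inv a \<in> M"
      using ab K NG by (auto simp: M_def conj_mult_inv subgroup.m_inv_closed)
  qed (use qM in \<open>auto simp: M_def\<close>)
  note MG = subgroup.mem_carrier[OF sM]
  have stable: "n \<otimes> x \<otimes> inv n \<in> M" if "n \<in> N" "x \<in> M" for n x
  proof -
    have "inv m \<otimes> (n \<otimes> x \<otimes> inv n) \<otimes> m \<in> K" if "m \<in> N" for m
    proof -
      have "inv n \<otimes> m \<in> N"
        using \<open>n \<in> N\<close> that sN by (simp add: subgroup.m_closed subgroup.m_inv_closed)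
      then have "inv (inv n \<otimes> m) \<otimes> x \<otimes> (inv n \<otimes> m) \<in> K"
        using \<open>x \<in> M\<close> by (auto simp: M_def)
      then show ?thesis
        using \<open>n \<in> N\<close> that \<open>x \<in> M\<close> NG MG by (simp add: inv_mult_group m_assoc inv_cancel_assoc)
    qed
    moreover have "n \<otimes> x \<otimes> inv n \<in> carrier G"
      using NG[OF that(1)] MG[OF that(2)] by simp
    ultimately show ?thesis unfolding M_def by blast
  qed
  define L where "L = normalizer G M"
  have sL: "subgroup L G"
    unfolding L_def by (rule normalizer_imp_subgroup[OF subgroup.subset[OF sM]])
  have "N \<subseteq> L"
  proof
    fix n assume n: "n \<in> N"
    have "n <# M #> inv n = M"
    proof
      show "n <# M #> inv n \<subseteq> M"
        using stable n by (auto simp: l_coset_def r_coset_def)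
      show "M \<subseteq> n <# M #> inv n"
      proof
        fix x assume x: "x \<in> M"
        have "inv n \<otimes> x \<otimes> n \<in> M"
          using stable[of "inv n" x] n x NG sN by (simp add: subgroup.m_inv_closed)
        moreover have "x = n \<otimes> (inv n \<otimes> x \<otimes> n) \<otimes> inv n"
          using n x NG MG by (simp add: m_assoc inv_cancel_assoc)
        ultimately show "x \<in> n <# M #> inv n"
          unfolding l_coset_def r_coset_def by blast
      qed
    qed
    then show "n \<in> L"
      using n NG subgroup.subset[OF sM] by (simp add: L_def normalizer_def stabilizer_def)
  qed
  then have L: "finite_index_subgroup L G"
    using finite_index_subgroup_mono N sL by blast
  have "M \<lhd> G\<lparr>carrier := L\<rparr>"
    unfolding L_def by (rule subgroup_in_normalizer[OF sM])
  moreover have "M \<noteq> {\<one>\<^bsub>G\<lparr>carrier := L\<rparr>\<^esub>}"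
    using qM q by auto
  moreover have "just_infinite (G\<lparr>carrier := L\<rparr>)"
    using hji L by (simp add: hereditarily_just_infinite_def)
  ultimately have "finite (rcosets\<^bsub>G\<lparr>carrier := L\<rparr>\<^esub> M)"
    unfolding just_infinite_def FactGroup_def by simp
  then show ?thesis
    using finite_index_subgroup_trans[OF L sM] finite_index_subgroup_mono K MK by blast
qed

section \<open>The profinite topology\<close>

lemma (in group) subgroup_profinite_closure:
  assumes H: "subgroup H G"
  shows "subgroup (profinite_topology G closure_of H) G"
proof -
  have "subgroup (H <#> N) G" if "N \<lhd> G" for N
    using that H commut_normal mult_norm_subgroup by metis
  then show ?thesis
    unfolding profinite_closure_eq[OF H]
    using finite_index_carrier by (intro subgroups_Inter) auto
qed

text \<open>
  If \<open>y = x\<^sup>-\<^sup>1 p x\<close> is outside the closure of \<open>H\<close>, then it is outside \<open>H N\<close> for some normal \<open>N\<close> of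
  finite index. Replacing \<open>x\<close> by an element of \<open>x N\<close> changes \<open>y\<close> only modulo \<open>N\<close>, so all of \<open>x N\<close> avoids
  the transporter.
\<close>

lemma (in group) closedin_profinite_transporter:
  assumes H: "subgroup H G" and p: "p \<in> carrier G"
  shows "closedin (profinite_topology G)
    {g \<in> carrier G. inv g \<otimes> p \<otimes> g \<in> profinite_topology G closure_of H}"
    (is "closedin _ ?X")
proof -
  have "\<exists>N. N \<lhd> G \<and> finite_index_subgroup N G \<and> x <# N \<subseteq> carrier G - ?X"
    if x: "x \<in> carrier G - ?X" for x
  proof -
    define y where "y = inv x \<otimes> p \<otimes> x"
    have xG: "x \<in> carrier G" and yG: "y \<in> carrier G" using x p by (auto simp: y_def)
    obtain N where N: "N \<lhd> G" "finite_index_subgroup N G" "y \<notin> H <#> N"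
      using x unfolding profinite_closure_eq[OF H] y_def by auto
    have sN: "subgroup N G" using N(1) by (rule normal_imp_subgroup)
    have "x \<otimes> n \<in> carrier G - ?X" if n: "n \<in> N" for n
    proof -
      have nG: "n \<in> carrier G" using sN n by (rule subgroup.mem_carrier)
      define z where "z = inv (x \<otimes> n) \<otimes> p \<otimes> (x \<otimes> n)"
      have z: "z = inv n \<otimes> y \<otimes> n"
        using xG nG p by (simp add: z_def y_def inv_mult_group m_assoc inv_cancel_assoc)
      have "z \<notin> H <#> N"
      proof
        assume "z \<in> H <#> N"
        then obtain h m where hm: "h \<in> H" "m \<in> N" "z = h \<otimes> m" by (auto simp: set_mult_def)
        have G: "h \<in> carrier G" "m \<in> carrier G"
          using subgroup.mem_carrier[OF H] subgroup.mem_carrier[OF sN] hm(1,2) by simp_all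
        \<comment> \<open>Moving \<open>n\<close> past \<open>h\<close> by normality of \<open>N\<close> brings \<open>y = n z n\<^sup>-\<^sup>1\<close> into the form \<open>h \<otimes> _\<close>.\<close>
        define n' where "n' = inv h \<otimes> n \<otimes> h"
        have n': "n' \<in> N"
          using normal.inv_op_closed1[OF N(1) G(1) n] by (simp add: n'_def)
        have "y = n \<otimes> z \<otimes> inv n"
          using yG nG by (simp add: z m_assoc inv_cancel_assoc)
        also have "\<dots> = h \<otimes> (n' \<otimes> m \<otimes> inv n)"
          using G nG by (simp add: hm n'_def m_assoc inv_cancel_assoc)
        finally have "y = h \<otimes> (n' \<otimes> m \<otimes> inv n)" .
        moreover have "n' \<otimes> m \<otimes> inv n \<in> N"
          using hm(2) n n' sN by (simp add: subgroup.m_closed subgroup.m_inv_closed)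
        ultimately have "y \<in> H <#> N"
          using hm(1) unfolding set_mult_def by blast
        then show False using N(3) by blast
      qed
      then have "z \<notin> profinite_topology G closure_of H"
        using N unfolding profinite_closure_eq[OF H] by blast
      then show ?thesis using xG nG by (simp add: z_def)
    qed
    then show ?thesis using N by (auto simp: l_coset_def)
  qed
  then show ?thesis
    unfolding closedin_def topspace_profinite_topology openin_profinite_topology_iff
    by blast
qed

text \<open>
  The finite, elementary case of the Baire property: if \<open>U\<close> is not inside one of the closed sets,
  remove that set from \<open>U\<close>; a non-empty open set is left that the others cover.
\<close>

lemma finite_closed_cover_of_open:
  assumes "finite P" "openin T U" "U \<noteq> {}"
    and "\<And>p. p \<in> P \<Longrightarrow> closedin T (X p)" and "U \<subseteq> (\<Union>p \<in> P. X p)"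
  obtains p V where "p \<in> P" "openin T V" "V \<noteq> {}" "V \<subseteq> X p"
proof -
  have "\<exists>p \<in> P. \<exists>V. openin T V \<and> V \<noteq> {} \<and> V \<subseteq> X p"
    using assms
  proof (induction P arbitrary: U rule: finite_induct)
    case empty
    then show ?case by auto
  next
    case (insert p P)
    show ?case
    proof (cases "U \<subseteq> X p")
      case True
      then show ?thesis using insert.prems by blast
    next
      case False
      have "openin T (U - X p)" using insert.prems by (simp add: openin_diff)
      moreover have "U - X p \<noteq> {}" "U - X p \<subseteq> (\<Union>p \<in> P. X p)"
        using False insert.prems by auto
      ultimately have "\<exists>p \<in> P. \<exists>V. openin T V \<and> V \<noteq> {} \<and> V \<subseteq> X p"
        using insert.IH insert.prems by blast
      then show ?thesis by blast
    qed
  qed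
  then show thesis using that by blast
qed

section \<open>Uniformly recurrent subgroups are confined\<close>

lemma openin_Sub_topology_mem:
  assumes "x \<in> carrier G"
  shows "openin (Sub_topology G) {H. subgroup H G \<and> x \<in> H}"
proof -
  let ?T = "product_topology (\<lambda>_. discrete_topology (UNIV :: bool set)) (carrier G)"
  have "openin ?T {f \<in> topspace ?T. f x \<in> {True}}"
    by (rule openin_continuous_map_preimage[OF continuous_map_product_projection[OF assms]]) simp
  then show ?thesis
    unfolding Sub_topology_def openin_pullback_topology
    using assms by (auto intro!: exI[of _ "{f \<in> topspace ?T. f x \<in> {True}}"])
qed

text \<open>
  Membership in a neighbourhood of \<open>A\<close> is forced by agreement with \<open>A\<close> on a finite set of group
  elements, as basic open sets of the product topology constrain finitely many coordinates.
\<close>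

lemma Sub_topology_nhd:
  assumes "openin (Sub_topology G) U" "A \<in> U"
  obtains F where "finite F" "F \<subseteq> carrier G"
    "\<And>B. subgroup B G \<Longrightarrow> B \<inter> F = A \<inter> F \<Longrightarrow> B \<in> U"
proof -
  let ?T = "product_topology (\<lambda>_. discrete_topology (UNIV :: bool set)) (carrier G)"
  let ?\<chi> = "\<lambda>B. \<lambda>g \<in> carrier G. g \<in> B"
  obtain V where V: "openin ?T V" "U = ?\<chi> -` V \<inter> {B. subgroup B G}"
    using assms(1) unfolding Sub_topology_def openin_pullback_topology by auto
  obtain W where W: "finite {g \<in> carrier G. W g \<noteq> (UNIV :: bool set)}"
      "?\<chi> A \<in> Pi\<^sub>E (carrier G) W" "Pi\<^sub>E (carrier G) W \<subseteq> V"
    using V assms(2) unfolding openin_product_topology_alt by fastforce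
  show thesis
  proof
    fix B assume B: "subgroup B G"
      "B \<inter> {g \<in> carrier G. W g \<noteq> UNIV} = A \<inter> {g \<in> carrier G. W g \<noteq> UNIV}"
    have "(g \<in> B) \<in> W g" if "g \<in> carrier G" for g
    proof (cases "W g = UNIV")
      case False
      then have "(g \<in> B) = (g \<in> A)" using B(2) that by blast
      then show ?thesis using W(2) that by (auto simp: PiE_iff)
    qed simp
    then have "?\<chi> B \<in> V" using W(3) by (auto simp: PiE_iff)
    then show "B \<in> U" using V(2) B(1) by simp
  qed (use W(1) in auto)
qed

text \<open>
  By minimality the one-point orbit of the trivial subgroup is dense in \<open>\<H>\<close>. A non-trivial \<open>L \<in> \<H>\<close>
  would contain some \<open>x \<noteq> \<one>\<close>, and the subgroups that contain \<open>x\<close> form a neighbourhood of \<open>L\<close> which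
  misses this orbit.
\<close>

lemma (in group) URS_eq_trivial:
  assumes "URS G \<H>" "{\<one>} \<in> \<H>"
  shows "\<H> = {{\<one>}}"
proof -
  have orbit: "orbit G (Sub_conj G) {\<one>} \<subseteq> {{\<one>}}"
    using triv_subgroup by (auto simp: orbit_def Sub_conj_def l_coset_def r_coset_def)
  have "L = {\<one>}" if "L \<in> \<H>" for L
  proof -
    have cl: "L \<in> Sub_topology G closure_of orbit G (Sub_conj G) {\<one>}"
      using assms that by (auto simp: URS_def)
    then have L: "subgroup L G"
      using topspace_Sub_topology by (metis in_closure_of mem_Collect_eq)
    have "x = \<one>" if "x \<in> L" for x
    proof -
      have "x \<in> carrier G" using L that by (rule subgroup.mem_carrier)
      then have "\<exists>B. B \<in> orbit G (Sub_conj G) {\<one>} \<and> B \<in> {B. subgroup B G \<and> x \<in> B}"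
        using cl L that openin_Sub_topology_mem[of x G] unfolding in_closure_of
        by (metis (no_types, lifting) mem_Collect_eq)
      then show ?thesis using orbit by auto
    qed
    then show ?thesis using subgroup.one_closed[OF L] by blast
  qed
  then show ?thesis using assms(2) by blast
qed

text \<open>
  The trivial subgroup has a neighbourhood that is disjoint from the closed set \<open>\<H>\<close>. Such a
  neighbourhood tests membership of finitely many elements, so each \<open>L \<in> \<H>\<close> contains a non-trivial
  one among them.
\<close>

lemma (in group) URS_meets_finite_set:
  assumes U: "URS G \<H>" and "\<H> \<noteq> {{\<one>}}"
  obtains P where "finite P" "P \<subseteq> carrier G - {\<one>}" "\<And>L. L \<in> \<H> \<Longrightarrow> L \<inter> P \<noteq> {}"
proof -
  have notin: "{\<one>} \<notin> \<H>" using assms URS_eq_trivial by blast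
  have cl: "closedin (Sub_topology G) \<H>" using U by (simp add: URS_def)
  have sub: "subgroup L G" if "L \<in> \<H>" for L
    using closedin_subset[OF cl] that by (auto simp: topspace_Sub_topology)
  have "openin (Sub_topology G) (topspace (Sub_topology G) - \<H>)"
    using cl by blast
  moreover have "{\<one>} \<in> topspace (Sub_topology G) - \<H>"
    using notin triv_subgroup by (simp add: topspace_Sub_topology)
  ultimately obtain F where F: "finite F" "F \<subseteq> carrier G"
      "\<And>B. subgroup B G \<Longrightarrow> B \<inter> F = {\<one>} \<inter> F \<Longrightarrow> B \<in> topspace (Sub_topology G) - \<H>"
    using Sub_topology_nhd by metis
  show thesis
  proof
    fix L assume L: "L \<in> \<H>"
    then have "L \<inter> F \<noteq> {\<one>} \<inter> F" using F(3) sub by blast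
    moreover have "\<one> \<in> L" using L sub subgroup.one_closed by blast
    ultimately show "L \<inter> (F - {\<one>}) \<noteq> {}" by blast
  qed (use F in auto)
qed

section \<open>Profinite closures in hereditarily just-infinite groups\<close>

lemma (in group) finite_index_profinite_closure_of_URS:
  assumes "hereditarily_just_infinite G"
    and "URS G \<H>"
    and "\<H> \<noteq> {{\<one>}}"
    and "H \<in> \<H>"
  shows "finite_index_subgroup (profinite_topology G closure_of H) G"
proof -
  have H: "subgroup H G"
    using assms(2,4) closedin_subset topspace_Sub_topology unfolding URS_def by blast
  define K where "K = profinite_topology G closure_of H"
  have K: "subgroup K G" unfolding K_def by (rule subgroup_profinite_closure[OF H])
  have HK: "H \<subseteq> K"
    unfolding K_def
    by (rule closure_of_subset) (simp add: topspace_profinite_topology subgroup.subset[OF H])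
  obtain P where P: "finite P" "P \<subseteq> carrier G - {\<one>}" "\<And>L. L \<in> \<H> \<Longrightarrow> L \<inter> P \<noteq> {}"
    using URS_meets_finite_set[OF assms(2,3)] by blast
  define X where "X p = {g \<in> carrier G. inv g \<otimes> p \<otimes> g \<in> K}" for p
  have "carrier G \<subseteq> (\<Union>p \<in> P. X p)"
  proof
    fix g assume g: "g \<in> carrier G"
    then have "Sub_conj G g H \<in> \<H>"
      using assms(2,4) by (simp add: URS_def)
    then have "g <# H #> inv g \<in> \<H>"
      using H by (simp add: Sub_conj_def)
    then obtain p where p: "p \<in> P" "p \<in> g <# H #> inv g" using P(3) by blast
    then obtain h where h: "h \<in> H" "p = g \<otimes> h \<otimes> inv g"
      by (auto simp: l_coset_def r_coset_def)
    have "inv g \<otimes> p \<otimes> g = h"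
      using g subgroup.mem_carrier[OF H h(1)]
      by (simp add: h(2) m_assoc inv_cancel_assoc)
    then have "g \<in> X p" using g h HK by (auto simp: X_def)
    then show "g \<in> (\<Union>p \<in> P. X p)" using p by blast
  qed
  moreover have "closedin (profinite_topology G) (X p)" if "p \<in> P" for p
    unfolding X_def K_def using that P(2) by (intro closedin_profinite_transporter H) auto
  moreover have "openin (profinite_topology G) (carrier G)"
    using openin_topspace topspace_profinite_topology by metis
  ultimately obtain p V where V: "p \<in> P" "openin (profinite_topology G) V" "V \<noteq> {}" "V \<subseteq> X p"
    using finite_closed_cover_of_open[OF P(1)] one_closed by (metis empty_iff)
  then obtain g N where gN: "g \<in> V" "N \<lhd> G" "finite_index_subgroup N G" "g <# N \<subseteq> V"
    unfolding openin_profinite_topology_iff by blast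
  have g: "g \<in> carrier G" and p: "p \<in> carrier G" "p \<noteq> \<one>"
    using gN V P(2) by (auto simp: X_def)
  define q where "q = inv g \<otimes> p \<otimes> g"
  have "inv n \<otimes> q \<otimes> n \<in> K" if n: "n \<in> N" for n
  proof -
    have nG: "n \<in> carrier G"
      using subgroup.mem_carrier[OF normal_imp_subgroup[OF gN(2)] n] .
    have "g \<otimes> n \<in> X p" using gN(4) V(4) n by (auto simp: l_coset_def)
    then show ?thesis
      using g nG p by (simp add: X_def q_def inv_mult_group m_assoc inv_cancel_assoc)
  qed
  moreover have "q \<in> carrier G" "q \<noteq> \<one>"
  proof -
    show "q \<in> carrier G" using g p by (simp add: q_def)
    have "p = g \<otimes> q \<otimes> inv g"
      using g p by (simp add: q_def m_assoc inv_cancel_assoc)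
    then show "q \<noteq> \<one>" using g p by auto
  qed
  ultimately have "finite_index_subgroup K G"
    using finite_index_if_contains_conjugates[OF assms(1) K gN(3)] by blast
  then show ?thesis by (simp add: K_def)
qed

theorem proposition3:
  fixes G :: "('a, 'b) monoid_scheme" and \<H> :: "'a set set" and H :: "'a set"
  assumes "hereditarily_just_infinite G"
    and "URS G \<H>"
    and "\<H> \<noteq> {{\<one>\<^bsub>G\<^esub>}}"
    and "H \<in> \<H>"
  shows "finite_index_subgroup (profinite_topology G closure_of H) G"
proof -
  interpret group G
    using assms(1) by (simp add: hereditarily_just_infinite_def)
  show ?thesis
    using assms by (rule finite_index_profinite_closure_of_URS)
qed

end
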